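(* Let $m,n\in\mathbb{Z}_{\geq 0}$ and let $G_1^{g_1},\ldots,G_m^{g_m},H_1^{h_1},\ldots,H_n^{h_n}$ be games with activeness. The following are equivalent: (a) There exists a game $X^1$ (an active game) such that $o(G_i^{g_i}+X^1)=\mathscr{P}$ for every $i\in[m]$ and $o(H_j^{h_j}+X^1)=\mathscr{N}$ for every $j\in[n]$. (b) Both of the following hold: (b1) $G_i^{g_i}\bowtie G_j^{g_j}$ for all $i,j\in[m]$; (b2) $G_i^{g_i}\neq H_j^{h_j}$ for all $i\in[m]$, $j\in[n]$.
   Context: Let $\mathcal{B}=\{0,1\}$. Define $\mathbb{I}_0=\{\emptyset\}\times\mathcal{B}$ and $\mathbb{I}_n=2^{\mathbb{I}_{n-1}}\times\mathcal{B}$ for $n\ge1$; a game with activeness is an element of $\mathbb{I}=\bigcup_{n\ge0}\mathbb{I}_n$. A pair $(G,g)$ is written $G^g$; the elements of $G$ are the options of $G^g$ (written $G'^{g'}\in G^g$), and $g=1$ means active, $g=0$ inactive. The outcome $o:\mathbb{I}\to\{\mathscr{P},\mathscr{N}\}$ is defined recursively by $o(G^g)=\mathscr{N}$ if $g=1$ and some option $G'^{g'}\in G^g$ has $o(G'^{g'})=\mathscr{P}$, and $o(G^g)=\mathscr{P}$ otherwise (i.e. if $g=0$ or all options are in $\mathscr{N}$). The sum is defined recursively by $G^g+H^h=(\{G'^{g'}+H^h:G'^{g'}\in G^g\}\cup\{G^g+H'^{h'}:H'^{h'}\in H^h\})^{\max\{g,h\}}$. Write $G^g=H^h$ iff $o(G^g+X^x)=o(H^h+X^x)$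 for all $X^x\in\mathbb{I}$, and $G^g\neq H^h$ otherwise. Write $G^g\bowtie H^h$ iff (1) $G'^{g'}\neq H^h$ for every option $G'^{g'}$ of $G^g$, and (2) $G^g\neq H'^{h'}$ for every option $H'^{h'}$ of $H^h$. $[k]=\{1,\dots,k\}$. *)

theory Defs
  imports "HOL-Library.FSet"
begin

text \<open>
  Every level \<open>\<I>\<^sub>n\<close> of the hierarchy is finite, so a game with activeness is a
  hereditarily finite set in which every node carries a bit; the bit \<open>1\<close> (active) is
  \<^const>\<open>True\<close>. The lemma \<open>UN_game_level\<close> below confirms that the datatype has exactly
  the elements of \<open>\<Union>n. \<I>\<^sub>n\<close>.
\<close>

datatype game = Game (options_of: "game fset") (active: bool)

fun game_level :: "nat \<Rightarrow> game set" where
  "game_level 0 = {Game {||} g | g. True}"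
| "game_level (Suc n) = {Game G g | G g. fset G \<subseteq> game_level n}"

lemma game_level_Suc_mono: "game_level n \<subseteq> game_level (Suc n)"
proof (induction n)
  case 0
  show ?case by auto
next
  case (Suc n)
  then show ?case by fastforce
qed

lemma game_level_mono: "m \<le> n \<Longrightarrow> game_level m \<subseteq> game_level n"
  by (rule lift_Suc_mono_le[of game_level, OF game_level_Suc_mono])

lemma UN_game_level: "(\<Union>n. game_level n) = UNIV"
proof -
  have "\<exists>n. x \<in> game_level n" for x
  proof (induction x)
    case (Game G g)
    then obtain f where f: "\<And>y. y \<in> fset G \<Longrightarrow> y \<in> game_level (f y)"
      by metis
    have "fset G \<subseteq> game_level (\<Sum>y\<in>fset G. f y)"
    proof
      fix y assume y: "y \<in> fset G"
      then have "f y \<le> (\<Sum>y\<in>fset G. f y)"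
        by (intro member_le_sum) auto
      with f[OF y] game_level_mono show "y \<in> game_level (\<Sum>y\<in>fset G. f y)"
        by blast
    qed
    then have "Game G g \<in> game_level (Suc (\<Sum>y\<in>fset G. f y))"
      by simp
    then show ?case by blast
  qed
  then show ?thesis by auto
qed

lemma size_option_less:
  assumes "x \<in> fset (options_of y)"
  shows "size x < size y"
proof (cases y)
  case (Game G g)
  with assms have "Suc (size x) \<le> (\<Sum>z\<in>fset G. Suc (size z))"
    by (intro member_le_sum[of x "fset G" "\<lambda>z. Suc (size z)"]) auto
  with Game show ?thesis by simp
qed

datatype outcome_class = \<P> | \<N>

function outcome :: "game \<Rightarrow> outcome_class" where
  "outcome G = (if active G \<and> (\<exists>G' \<in> fset (options_of G). outcome G' = \<P>) then \<N> else \<P>)"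
  by auto
termination
  by (relation "measure size") (auto simp: size_option_less)

declare outcome.simps [simp del]

text \<open>On \<^typ>\<open>bool\<close>, \<^const>\<open>max\<close> is the maximum for \<open>False < True\<close>.\<close>

function game_sum :: "game \<Rightarrow> game \<Rightarrow> game" (infixl "\<oplus>" 65) where
  "G \<oplus> H = Game
     ((\<lambda>G'. G' \<oplus> H) |`| options_of G |\<union>| (\<lambda>H'. G \<oplus> H') |`| options_of H)
     (max (active G) (active H))"
  by auto
termination
  by (relation "measure (\<lambda>(G, H). size G + size H)") (auto simp: size_option_less)

declare game_sum.simps [simp del]

text \<open>The equality of games is indistinguishability in sums, not equality of terms.\<close>

definition game_eq :: "game \<Rightarrow> game \<Rightarrow> bool" (infix "\<approx>" 50) where
  "G \<approx> H \<longleftrightarrow> (\<forall>X. outcome (G \<oplus> X) = outcome (H \<oplus> X))"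


definition game_bowtie :: "game \<Rightarrow> game \<Rightarrow> bool" (infix "\<bowtie>" 50) where
  "G \<bowtie> H \<longleftrightarrow>
     (\<forall>G' \<in> fset (options_of G). \<not> G' \<approx> H) \<and>
     (\<forall>H' \<in> fset (options_of H). \<not> G \<approx> H')"

end

theory Submission imports Defs begin

text \<open>
  A move to \<open>C \<oplus> X\<close> with \<open>C\<close> unwanted should be answered by a move in \<open>X\<close> to some
  \<open>Y\<close> with \<open>C \<oplus> Y\<close> in \<open>\<P>\<close>, so \<open>X\<close> is built as the active game whose options are such
  replies \<open>Y\<close>, one for each unwanted \<open>C\<close>: the games \<open>H\<^sub>j\<close> and the options of the \<open>G\<^sub>i\<close>. The
  replies must satisfy \<open>G\<^sub>i \<oplus> Y\<close> in \<open>\<N>\<close> for all \<open>i\<close>. They are obtained by applying the same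
  construction three times: first to find for each game an active \<open>Z\<close> with sum in \<open>\<P>\<close> (hence no
  game equals one of its options), then to separate two distinct games by an active game in either
  direction, then to separate one game from finitely many.
\<close>

lemma active_sum [simp]: "active (G \<oplus> H) \<longleftrightarrow> active G \<or> active H"
  by (subst game_sum.simps) (auto simp: max_def)

lemma outcome_sum_eq_N_iff:
  "outcome (G \<oplus> H) = \<N> \<longleftrightarrow> (active G \<or> active H) \<and>
     ((\<exists>G' \<in> fset (options_of G). outcome (G' \<oplus> H) = \<P>) \<or>
      (\<exists>H' \<in> fset (options_of H). outcome (G \<oplus> H') = \<P>))"
proof -
  have "fset (options_of (G \<oplus> H)) =
      (\<lambda>G'. G' \<oplus> H) ` fset (options_of G) \<union> (\<lambda>H'. G \<oplus> H') ` fset (options_of H)"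
    by (subst game_sum.simps) simp
  then show ?thesis
    by (subst outcome.simps) auto
qed

lemma outcome_neq_P_iff: "x \<noteq> \<P> \<longleftrightarrow> x = \<N>"
  by (cases x) auto

lemma game_eq_sym: "G \<approx> H \<Longrightarrow> H \<approx> G"
  by (simp add: game_eq_def)

text \<open>\<open>X\<close> itself tells \<open>G'\<close> and \<open>H\<close> apart: since
  \<open>G \<oplus> X\<close> is active and in \<open>\<P>\<close>, the move to
  \<open>G' \<oplus> X\<close> must lead to \<open>\<N>\<close>.\<close>

lemma option_not_game_eq:
  assumes "active X" "outcome (G \<oplus> X) = \<P>" "outcome (H \<oplus> X) = \<P>"
    and "G' \<in> fset (options_of G)"
  shows "\<not> G' \<approx> H"
proof -
  have "outcome (G' \<oplus> X) \<noteq> \<P>"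
    using assms(1,2,4) outcome_sum_eq_N_iff[of G X] by auto
  with assms(3) show ?thesis
    by (metis game_eq_def)
qed

lemma separating_game_from_replies:
  assumes "finite A" "finite B"
    and reply: "\<And>C. C \<in> B \<union> (\<Union>G\<in>A. fset (options_of G)) \<Longrightarrow>
      \<exists>Y. outcome (C \<oplus> Y) = \<P> \<and> (\<forall>G\<in>A. outcome (G \<oplus> Y) = \<N>)"
  obtains X where "active X" "\<And>G. G \<in> A \<Longrightarrow> outcome (G \<oplus> X) = \<P>"
    "\<And>H. H \<in> B \<Longrightarrow> outcome (H \<oplus> X) = \<N>"
proof -
  define U where "U = B \<union> (\<Union>G\<in>A. fset (options_of G))"
  have "finite U"
    using assms(1,2) by (simp add: U_def)
  obtain f where f: "\<And>C. C \<in> U \<Longrightarrow> outcome (C \<oplus> f C) = \<P>"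
      "\<And>C G. C \<in> U \<Longrightarrow> G \<in> A \<Longrightarrow> outcome (G \<oplus> f C) = \<N>"
    using reply unfolding U_def by metis
  \<comment> \<open>The bit \<open>True\<close> makes every sum with \<open>X\<close> active, so
    moving to \<open>C \<oplus> f C\<close> puts \<open>C \<oplus> X\<close> in
    \<open>\<N>\<close>.\<close>
  define X where "X = Game (Abs_fset (f ` U)) True"
  have opts: "fset (options_of X) = f ` U" and act: "active X"
    using \<open>finite U\<close> by (simp_all add: X_def Abs_fset_inverse)
  have N: "outcome (C \<oplus> X) = \<N>" if "C \<in> U" for C
    using f(1)[OF that] that act by (auto simp: outcome_sum_eq_N_iff[of C X] opts)
  have P: "outcome (G \<oplus> X) = \<P>" if "G \<in> A" for G
  proof -
    have "outcome (G \<oplus> X) \<noteq> \<N>"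
    proof
      assume "outcome (G \<oplus> X) = \<N>"
      then consider G' where "G' \<in> fset (options_of G)" "outcome (G' \<oplus> X) = \<P>"
        | C where "C \<in> U" "outcome (G \<oplus> f C) = \<P>"
        by (auto simp: outcome_sum_eq_N_iff[of G X] opts)
      then show False
      proof cases
        case 1
        with that have "G' \<in> U"
          by (auto simp: U_def)
        from N[OF this] 1 show False
          by simp
      next
        case 2
        with f(2) that show False
          by simp
      qed
    qed
    then show ?thesis
      by (cases "outcome (G \<oplus> X)") auto
  qed
  show thesis
    using that[of X] act N P by (auto simp: U_def)
qed

text \<open>By induction each option \<open>C\<close> of \<open>K\<close> has an active
  \<open>Y\<close> with \<open>C \<oplus> Y\<close> in \<open>\<P>\<close>. The move from
  \<open>K\<close> to \<open>C\<close> then puts \<open>K \<oplus> Y\<close> in \<open>\<N>\<close>,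
  so \<open>Y\<close> is a valid reply.\<close>

lemma exists_active_sum_P: "\<exists>Z. active Z \<and> outcome (K \<oplus> Z) = \<P>"
proof (induction K)
  case (Game S k)
  obtain Z where "active Z" "\<And>G. G \<in> {Game S k} \<Longrightarrow> outcome (G \<oplus> Z) = \<P>"
  proof (rule separating_game_from_replies[of "{Game S k}" "{}"])
    fix C
    assume "C \<in> {} \<union> (\<Union>G\<in>{Game S k}. fset (options_of G))"
    then have C: "C \<in> fset S"
      by simp
    with Game obtain Y where "active Y" "outcome (C \<oplus> Y) = \<P>"
      by blast
    with C show "\<exists>Y. outcome (C \<oplus> Y) = \<P> \<and> (\<forall>G\<in>{Game S k}. outcome (G \<oplus> Y) = \<N>)"
      by (intro exI[of _ Y]) (auto simp: outcome_sum_eq_N_iff[of "Game S k"])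
  qed auto
  then show ?case
    by blast
qed

lemma option_neq_self: "K' \<in> fset (options_of K) \<Longrightarrow> \<not> K' \<approx> K"
  using exists_active_sum_P[of K] option_not_game_eq by blast

text \<open>The given \<open>X\<close> is exactly the reply needed for \<open>H\<close>. Options of
  \<open>K\<close> get theirs from \<open>exists_active_sum_P\<close>.\<close>

lemma reverse_separation:
  assumes "outcome (H \<oplus> X) = \<P>" "outcome (K \<oplus> X) = \<N>"
  shows "\<exists>Y. active Y \<and> outcome (K \<oplus> Y) = \<P> \<and> outcome (H \<oplus> Y) = \<N>"
proof -
  obtain Y where "active Y" "\<And>G. G \<in> {K} \<Longrightarrow> outcome (G \<oplus> Y) = \<P>"
    "\<And>G. G \<in> {H} \<Longrightarrow> outcome (G \<oplus> Y) = \<N>"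
  proof (rule separating_game_from_replies[of "{K}" "{H}"])
    fix C
    assume "C \<in> {H} \<union> (\<Union>G\<in>{K}. fset (options_of G))"
    then consider "C = H" | "C \<in> fset (options_of K)"
      by auto
    then show "\<exists>Y. outcome (C \<oplus> Y) = \<P> \<and> (\<forall>G\<in>{K}. outcome (G \<oplus> Y) = \<N>)"
    proof cases
      case 1
      with assms show ?thesis
        by auto
    next
      case 2
      obtain Z where "active Z" "outcome (C \<oplus> Z) = \<P>"
        using exists_active_sum_P by blast
      with 2 show ?thesis
        by (intro exI[of _ Z]) (auto simp: outcome_sum_eq_N_iff[of K])
    qed
  qed auto
  then show ?thesis
    by blast
qed

lemma separate_two:
  assumes "\<not> K \<approx> H"
  shows "\<exists>Y. active Y \<and> outcome (K \<oplus> Y) = \<P> \<and> outcome (H \<oplus> Y) = \<N>"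
proof -
  obtain X where "outcome (K \<oplus> X) \<noteq> outcome (H \<oplus> X)"
    using assms by (auto simp: game_eq_def)
  then consider "outcome (H \<oplus> X) = \<P>" "outcome (K \<oplus> X) = \<N>"
    | "outcome (K \<oplus> X) = \<P>" "outcome (H \<oplus> X) = \<N>"
    by (metis outcome_neq_P_iff)
  then show ?thesis
  proof cases
    case 1
    then show ?thesis
      by (rule reverse_separation)
  next
    case 2
    \<comment> \<open>\<open>X\<close> itself may be inactive; reversing twice makes it active.\<close>
    then obtain Y where "outcome (H \<oplus> Y) = \<P>" "outcome (K \<oplus> Y) = \<N>"
      using reverse_separation by blast
    then show ?thesis
      by (rule reverse_separation)
  qed
qed

text \<open>Every element of \<open>B\<close> and every option of \<open>K\<close> differs from
  \<open>K\<close>. Since only the single game \<open>K\<close> must be sent to \<open>\<N>\<close>,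
  a reply from \<open>separate_two\<close> suffices.\<close>

lemma separate_one_from_finite:
  assumes "finite B" "\<And>H. H \<in> B \<Longrightarrow> \<not> K \<approx> H"
  shows "\<exists>Y. outcome (K \<oplus> Y) = \<P> \<and> (\<forall>H\<in>B. outcome (H \<oplus> Y) = \<N>)"
proof -
  obtain Y where "\<And>G. G \<in> {K} \<Longrightarrow> outcome (G \<oplus> Y) = \<P>"
    "\<And>H. H \<in> B \<Longrightarrow> outcome (H \<oplus> Y) = \<N>"
  proof (rule separating_game_from_replies[of "{K}" B])
    fix C
    assume "C \<in> B \<union> (\<Union>G\<in>{K}. fset (options_of G))"
    then have "\<not> C \<approx> K"
      using assms(2) option_neq_self game_eq_sym by blast
    then show "\<exists>Y. outcome (C \<oplus> Y) = \<P> \<and> (\<forall>G\<in>{K}. outcome (G \<oplus> Y) = \<N>)"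
      using separate_two by blast
  qed (use assms(1) in auto)
  then show ?thesis
    by blast
qed

text \<open>The relation \<open>\<bowtie>\<close> on \<open>A\<close> makes options of its members
  differ from all of \<open>A\<close>, so the previous lemma, with \<open>A\<close> as the finite
  set to be sent to \<open>\<N>\<close>, supplies the replies.\<close>

lemma exists_separating_game:
  assumes "finite A" "finite B"
    and "\<And>G H. G \<in> A \<Longrightarrow> H \<in> A \<Longrightarrow> G \<bowtie> H"
    and "\<And>G H. G \<in> A \<Longrightarrow> H \<in> B \<Longrightarrow> \<not> G \<approx> H"
  obtains X where "active X" "\<And>G. G \<in> A \<Longrightarrow> outcome (G \<oplus> X) = \<P>"
    "\<And>H. H \<in> B \<Longrightarrow> outcome (H \<oplus> X) = \<N>"
proof (rule separating_game_from_replies[OF assms(1,2)])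
  fix C
  assume "C \<in> B \<union> (\<Union>G\<in>A. fset (options_of G))"
  then have "\<not> C \<approx> G" if "G \<in> A" for G
    using assms(3,4) that game_eq_sym unfolding game_bowtie_def by blast
  then show "\<exists>Y. outcome (C \<oplus> Y) = \<P> \<and> (\<forall>G\<in>A. outcome (G \<oplus> Y) = \<N>)"
    by (rule separate_one_from_finite[OF assms(1)])
qed (use that in blast)

theorem theorem3p29:
  fixes m n :: nat and G H :: "nat \<Rightarrow> game"
  shows "(\<exists>X. active X \<and>
            (\<forall>i \<in> {1..m}. outcome (G i \<oplus> X) = \<P>) \<and>
            (\<forall>j \<in> {1..n}. outcome (H j \<oplus> X) = \<N>)) \<longleftrightarrow>
         (\<forall>i \<in> {1..m}. \<forall>j \<in> {1..m}. G i \<bowtie> G j) \<and>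
         (\<forall>i \<in> {1..m}. \<forall>j \<in> {1..n}. \<not> G i \<approx> H j)"
  (is "?sep \<longleftrightarrow> ?bowtie \<and> ?neq")
proof
  assume ?sep
  then obtain X where X: "active X" "\<And>i. i \<in> {1..m} \<Longrightarrow> outcome (G i \<oplus> X) = \<P>"
      "\<And>j. j \<in> {1..n} \<Longrightarrow> outcome (H j \<oplus> X) = \<N>"
    by blast
  \<comment> \<open>The same \<open>X\<close> witnesses both halves of \<open>\<bowtie>\<close>; the
    second needs the symmetry of \<open>\<approx>\<close>.\<close>
  have ?bowtie
    unfolding game_bowtie_def using X(1,2) option_not_game_eq game_eq_sym by blast
  moreover have ?neq
    using X(2,3) unfolding game_eq_def by (metis outcome_class.distinct(1))
  ultimately show "?bowtie \<and> ?neq" ..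
next
  assume b: "?bowtie \<and> ?neq"
  obtain X where "active X" "\<And>K. K \<in> G ` {1..m} \<Longrightarrow> outcome (K \<oplus> X) = \<P>"
    "\<And>K. K \<in> H ` {1..n} \<Longrightarrow> outcome (K \<oplus> X) = \<N>"
    by (rule exists_separating_game[of "G ` {1..m}" "H ` {1..n}"]) (use b in auto)
  then show ?sep
    by blast
qed

end
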